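(* Let $m,n\ge 1$ and consider the system $$\dot r=P(t,r,\theta),\qquad \dot\theta=A(r)+Q(t,r,\theta),\qquad r\in\mathbf R^m_+,\ \theta\in\mathbf T^n,$$ where $A\in C^1(\mathbf R^m_+,\mathbf R^n)$ has all components $A_k(r)>0$, and $P\in C^{0,1,1}_{t,r,\theta}(\mathbf R\times\mathbf R^m_+\times\mathbf T^n,\mathbf R^m)$, $Q\in C^{0,1,1}_{t,r,\theta}(\mathbf R\times\mathbf R^m_+\times\mathbf T^n,\mathbf R^n)$. Suppose that for some real $p>2$ at least one of the following (equivalent) assumptions holds: (i) $t^p\|P(t,r,\theta)\|\to 0$ and $t^p\|Q(t,r,\theta)\|\to0$ as $t\to+\infty$, uniformly with respect to $r$ in each compact subset of $\mathbf R^m_+$ and $\theta\in\mathbf T^n$; (ii) there are positive continuous scalar functions $\alpha(s)$, $\beta(t)$ with $\alpha$ increasing, $\beta$ decreasing, $\lim_{t\to\infty}\beta(t)=0$, and $t^p\|P(t,r,\theta)\|\le\alpha(\|r\|)\beta(t)$, $t^p\|Q(t,r,\theta)\|\le\alpha(\|r\|)\beta(t)$. Then each bounded solution $(r(t),\theta(t))$ of the system converges to a certain solution of the unperturbed system $\dot r=0,\ \dot\theta=A(r)$; that is, there exist $r^*\in\mathbf R^m_+$ and $\theta_0\in\mathbf R^n$ such that $$\lim_{t\to+\infty}\bigl(r(t)-r^*\bigr)=0,\qquad \lim_{t\to+\infty}\bigl(\theta(t)-A(r^* )t-\theta_0\bigr)=0 .$$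
   Context: $\mathbf R_+=[0,+\infty)$, $\mathbf R^m_+=[0,+\infty)^m$, and $\mathbf T^n$ is the $n$-dimensional torus. Writing $\theta\in\mathbf T^n$ means that $\theta\in\mathbf R^n$ and the functions $P,Q$ are periodic (with constant period) in each component of $\theta$. $C^{0,1,1}_{t,r,\theta}$ denotes functions continuous in all variables and continuously differentiable with respect to $r$ and $\theta$. $\|\cdot\|$ is the Euclidean norm. A bounded solution is a solution $(r(t),\theta(t))$ defined on some half-line $[t_0,+\infty)$ that is bounded with respect to the $r$-coordinates, i.e. $\sup_{t\ge t_0}\|r(t)\|<\infty$; $\theta(t)$ is regarded as an $\mathbf R^n$-valued function. The solutions of the unperturbed system $\dot r=0,\ \dot\theta=A(r)$ are $(r^*,A(r^* )t+\theta_0)$. *)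

theory Defs
  imports "HOL-Analysis.Analysis"
begin

definition nonneg_orthant :: "(real ^ 'm) set" where
  "nonneg_orthant = {r. \<forall>i. 0 \<le> r $ i}"

text \<open>On a set with boundary such as the orthant, derivatives are taken relative to the set.\<close>

definition C1_on :: "('a::real_normed_vector) set \<Rightarrow> ('a \<Rightarrow> 'b::real_normed_vector) \<Rightarrow> bool" where
  "C1_on S f \<longleftrightarrow> (\<exists>f' :: 'a \<Rightarrow> 'a \<Rightarrow>\<^sub>L 'b.
     (\<forall>x\<in>S. (f has_derivative blinfun_apply (f' x)) (at x within S)) \<and> continuous_on S f')"

text \<open>The class \<open>C\<^sup>0\<^sup>,\<^sup>1\<^sup>,\<^sup>1\<close> in \<open>(t, r, \<theta>)\<close>: continuity of the function and of its partial (Frechet)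
  derivatives in \<open>r\<close> and \<open>\<theta>\<close> is joint continuity in all three variables.\<close>

definition C011 :: "(real \<Rightarrow> real ^ 'm \<Rightarrow> real ^ 'n \<Rightarrow> 'b::real_normed_vector) \<Rightarrow> bool" where
  "C011 F \<longleftrightarrow>
     continuous_on (UNIV \<times> nonneg_orthant \<times> UNIV) (\<lambda>(t, r, \<theta>). F t r \<theta>) \<and>
     (\<exists>Fr :: real \<Rightarrow> real ^ 'm \<Rightarrow> real ^ 'n \<Rightarrow> (real ^ 'm) \<Rightarrow>\<^sub>L 'b.
        (\<forall>t. \<forall>r\<in>nonneg_orthant. \<forall>\<theta>.
           ((\<lambda>x. F t x \<theta>) has_derivative blinfun_apply (Fr t r \<theta>)) (at r within nonneg_orthant)) \<and>
        continuous_on (UNIV \<times> nonneg_orthant \<times> UNIV) (\<lambda>(t, r, \<theta>). Fr t r \<theta>)) \<and>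
     (\<exists>Fth :: real \<Rightarrow> real ^ 'm \<Rightarrow> real ^ 'n \<Rightarrow> (real ^ 'n) \<Rightarrow>\<^sub>L 'b.
        (\<forall>t. \<forall>r\<in>nonneg_orthant. \<forall>\<theta>.
           ((\<lambda>y. F t r y) has_derivative blinfun_apply (Fth t r \<theta>)) (at \<theta>)) \<and>
        continuous_on (UNIV \<times> nonneg_orthant \<times> UNIV) (\<lambda>(t, r, \<theta>). Fth t r \<theta>))"

text \<open>A function on the torus is a function of \<open>\<theta>\<close> in Euclidean space that is periodic in each
  component; \<open>T $ k\<close> is the period of the \<open>k\<close>-th component.\<close>

definition torus_periodic ::
  "real ^ 'n \<Rightarrow> (real \<Rightarrow> real ^ 'm \<Rightarrow> real ^ 'n \<Rightarrow> 'b) \<Rightarrow> bool" where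
  "torus_periodic T F \<longleftrightarrow>
     (\<forall>t. \<forall>r\<in>nonneg_orthant. \<forall>\<theta> k. F t r (\<theta> + axis k (T $ k)) = F t r \<theta>)"

definition decays_uniformly ::
  "real \<Rightarrow> (real \<Rightarrow> real ^ 'm \<Rightarrow> real ^ 'n \<Rightarrow> 'b::real_normed_vector) \<Rightarrow> bool" where
  "decays_uniformly p F \<longleftrightarrow>
     (\<forall>K. compact K \<and> K \<subseteq> nonneg_orthant \<longrightarrow>
        uniform_limit (K \<times> UNIV) (\<lambda>t (r, \<theta>). t powr p * norm (F t r \<theta>)) (\<lambda>_. 0) at_top)"

text \<open>The majorants are functions on the half-line, and the estimates are required for \<open>t \<ge> 0\<close>,
  where the real power \<open>t\<^sup>p\<close> makes sense. Monotonicity is not required to be strict.\<close>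

definition majorant_pair :: "(real \<Rightarrow> real) \<Rightarrow> (real \<Rightarrow> real) \<Rightarrow> bool" where
  "majorant_pair \<alpha> \<beta> \<longleftrightarrow>
     continuous_on {0..} \<alpha> \<and> (\<forall>s\<ge>0. 0 < \<alpha> s) \<and> mono_on {0..} \<alpha> \<and>
     continuous_on {0..} \<beta> \<and> (\<forall>t\<ge>0. 0 < \<beta> t) \<and> antimono_on {0..} \<beta> \<and>
     (\<beta> \<longlongrightarrow> 0) at_top"

definition majorized_by ::
  "real \<Rightarrow> (real \<Rightarrow> real) \<Rightarrow> (real \<Rightarrow> real) \<Rightarrow>
   (real \<Rightarrow> real ^ 'm \<Rightarrow> real ^ 'n \<Rightarrow> 'b::real_normed_vector) \<Rightarrow> bool" where
  "majorized_by p \<alpha> \<beta> F \<longleftrightarrow>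
     (\<forall>t\<ge>0. \<forall>r\<in>nonneg_orthant. \<forall>\<theta>. t powr p * norm (F t r \<theta>) \<le> \<alpha> (norm r) * \<beta> t)"

definition solution_on_half_line ::
  "(real ^ 'm \<Rightarrow> real ^ 'n) \<Rightarrow>
   (real \<Rightarrow> real ^ 'm \<Rightarrow> real ^ 'n \<Rightarrow> real ^ 'm) \<Rightarrow>
   (real \<Rightarrow> real ^ 'm \<Rightarrow> real ^ 'n \<Rightarrow> real ^ 'n) \<Rightarrow>
   real \<Rightarrow> (real \<Rightarrow> real ^ 'm) \<Rightarrow> (real \<Rightarrow> real ^ 'n) \<Rightarrow> bool" where
  "solution_on_half_line A P Q t0 r \<theta> \<longleftrightarrow>
     (\<forall>t\<ge>t0. r t \<in> nonneg_orthant \<and>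
        (r has_vector_derivative P t (r t) (\<theta> t)) (at t within {t0..}) \<and>
        (\<theta> has_vector_derivative A (r t) + Q t (r t) (\<theta> t)) (at t within {t0..}))"

definition bounded_solution ::
  "(real ^ 'm \<Rightarrow> real ^ 'n) \<Rightarrow>
   (real \<Rightarrow> real ^ 'm \<Rightarrow> real ^ 'n \<Rightarrow> real ^ 'm) \<Rightarrow>
   (real \<Rightarrow> real ^ 'm \<Rightarrow> real ^ 'n \<Rightarrow> real ^ 'n) \<Rightarrow>
   real \<Rightarrow> (real \<Rightarrow> real ^ 'm) \<Rightarrow> (real \<Rightarrow> real ^ 'n) \<Rightarrow> bool" where
  "bounded_solution A P Q t0 r \<theta> \<longleftrightarrow>
     solution_on_half_line A P Q t0 r \<theta> \<and> bounded (r ` {t0..})"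

end

theory Submission imports Defs begin

text \<open>Along a bounded solution the values of \<open>r\<close> stay in a compact convex subset of the orthant, so
  \<open>P\<close> and \<open>Q\<close> are eventually at most \<open>t\<^sup>-\<^sup>p\<close> there. Integrating a tail bound \<open>t\<^sup>-\<^sup>q\<close> with \<open>q > 1\<close>
  gives a limit that is approached at rate \<open>t\<^sup>1\<^sup>-\<^sup>q\<close>. This yields \<open>r\<^sup>*\<close> with \<open>q = p\<close>; since \<open>A\<close> is
  Lipschitz on the compact set, \<open>\<theta>(t) - t A(r\<^sup>*)\<close> has derivative of order \<open>t\<^sup>1\<^sup>-\<^sup>p\<close>, and \<open>p > 2\<close> permits
  a second application with \<open>q = p - 1\<close>.\<close>

section \<open>Limits at infinity, with a rate, from tail bounds\<close>

lemma dist_tail_bound_imp_limit: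
  fixes x :: "real \<Rightarrow> 'a::complete_space"
  assumes bd: "\<And>s t. s0 \<le> s \<Longrightarrow> s \<le> t \<Longrightarrow> dist (x s) (x t) \<le> g s"
    and g: "(g \<longlongrightarrow> 0) at_top"
  obtains L where "(x \<longlongrightarrow> L) at_top" and "\<And>s. s0 \<le> s \<Longrightarrow> dist (x s) L \<le> g s"
proof -
  \<comment> \<open>Completeness is applied along the integers only. Letting the later time run
    through the integers passes the bound \<open>g s\<close> to the distance from \<open>L\<close>,
    for every real \<open>s\<close> from \<open>s0\<close> on; as \<open>g\<close> tends to 0, the
    limit then holds along all real times.\<close>
  have "Cauchy (\<lambda>n. x (real n))"
  proof (rule metric_CauchyI)
    fix e :: real assume "0 < e"
    then have "eventually (\<lambda>s. g s < e / 2) at_top"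
      by (intro order_tendstoD(2)[OF g]) simp
    then obtain N0 where N0: "\<And>s. s \<ge> N0 \<Longrightarrow> g s < e / 2"
      by (auto simp: eventually_at_top_linorder)
    define s where "s = max s0 N0"
    have d: "dist (x s) (x (real n)) < e / 2" if "nat \<lceil>s\<rceil> \<le> n" for n
    proof -
      have "s \<le> real n" using that by linarith
      then show ?thesis using bd[of s "real n"] N0[of s] by (auto simp: s_def)
    qed
    have "dist (x (real m)) (x (real n)) < e" if "nat \<lceil>s\<rceil> \<le> m" "nat \<lceil>s\<rceil> \<le> n" for m n
      using d[OF that(1)] d[OF that(2)] by (rule dist_triangle_half_r)
    then show "\<exists>M. \<forall>m\<ge>M. \<forall>n\<ge>M. dist (x (real m)) (x (real n)) < e"
      by blast
  qed
  then obtain L where L: "(\<lambda>n. x (real n)) \<longlonglongrightarrow> L"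
    using Cauchy_convergent convergent_def by blast
  have rate: "dist (x s) L \<le> g s" if "s0 \<le> s" for s
  proof (rule tendsto_upperbound)
    show "(\<lambda>n. dist (x s) (x (real n))) \<longlonglongrightarrow> dist (x s) L"
      by (intro tendsto_intros L)
    show "eventually (\<lambda>n. dist (x s) (x (real n)) \<le> g s) sequentially"
      using eventually_ge_at_top[of "nat \<lceil>s\<rceil>"]
    proof eventually_elim
      case (elim n)
      then have "s \<le> real n" by linarith
      then show ?case using bd that by blast
    qed
  qed simp
  have "((\<lambda>t. dist (x t) L) \<longlongrightarrow> 0) at_top"
  proof (rule tendsto_sandwich[OF _ _ tendsto_const g])
    show "eventually (\<lambda>t. dist (x t) L \<le> g t) at_top"
      using eventually_ge_at_top[of s0] by eventually_elim (rule rate)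
  qed simp
  then have "(x \<longlongrightarrow> L) at_top"
    by (rule tendsto_dist_iff[THEN iffD2])
  then show ?thesis using rate by (rule that)
qed

text \<open>The increment of \<open>x\<close> beyond \<open>s\<close> is at most the tail integral
  of \<open>C * t powr - q\<close>, which equals \<open>C / (q - 1) * s powr (1 - q)\<close> because
  \<open>q > 1\<close>. The mean value inequality takes the place of integrating
  \<open>x'\<close>.\<close>

lemma powr_derivative_bound_imp_limit:
  fixes x x' :: "real \<Rightarrow> 'a::banach"
  assumes q: "1 < q" and s0: "0 < s0"
    and der: "\<And>t. s0 \<le> t \<Longrightarrow> (x has_vector_derivative x' t) (at t within {s0..})"
    and bd: "\<And>t. s0 \<le> t \<Longrightarrow> norm (x' t) \<le> C * t powr - q"
  obtains L where "(x \<longlongrightarrow> L) at_top"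
    and "\<And>t. s0 \<le> t \<Longrightarrow> norm (x t - L) \<le> C / (q - 1) * t powr (1 - q)"
proof -
  define g where "g t = C / (q - 1) * t powr (1 - q)" for t
  \<comment> \<open>The sign of \<open>C\<close> is read off from the derivative bound at
    \<open>s0\<close>; it is what makes \<open>g\<close> nonnegative.\<close>
  have "0 \<le> C * s0 powr - q"
    using bd[of s0] norm_ge_zero order_trans by blast
  then have C: "0 \<le> C"
    using s0 by (simp add: zero_le_mult_iff)
  have g_nonneg: "0 \<le> g t" for t
    using C q by (simp add: g_def)
  have gder: "((\<lambda>t. - g t) has_vector_derivative C * t powr - q) (at t)" if "0 < t" for t
  proof -
    have "((\<lambda>t. - g t) has_real_derivative - (C / (q - 1) * ((1 - q) * t powr (1 - q - 1)))) (at t)"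
      unfolding g_def using that
      by (intro DERIV_minus DERIV_cmult has_real_derivative_powr)
    moreover have "- (C / (q - 1) * ((1 - q) * t powr (1 - q - 1))) = C * t powr - q"
      using q by (simp add: field_simps)
    ultimately show ?thesis
      by (simp add: has_real_derivative_iff_has_vector_derivative)
  qed
  have main: "dist (x s) (x t) \<le> g s" if "s0 \<le> s" "s \<le> t" for s t
  proof (cases "s = t")
    case False
    then have "s < t" using that by simp
    \<comment> \<open>\<open>- g\<close> is the antiderivative of the bound that vanishes at
      infinity, so dropping \<open>- g t \<le> 0\<close> leaves a bound independent of the later
      time.\<close>
    have "norm (x t - x s) \<le> - g t - - g s"
    proof (rule differentiable_bound_general[OF \<open>s < t\<close>])
      show "continuous_on {s..t} x"
      proof (rule continuous_on_subset)
        show "continuous_on {s0..} x"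
          using der by (auto simp: continuous_on_eq_continuous_within
              intro: has_vector_derivative_continuous)
      qed (use that in auto)
      show "continuous_on {s..t} (\<lambda>t. - g t)"
        using gder that s0
        by (intro continuous_at_imp_continuous_on ballI has_vector_derivative_continuous[OF gder]) auto
      fix u assume u: "s < u" "u < t"
      show "((\<lambda>t. - g t) has_vector_derivative C * u powr - q) (at u)"
        using gder u that s0 by simp
      have "at u within {s0..} = at u"
        using u that by (intro at_within_interior) (simp add: interior_real_atLeast)
      then show "(x has_vector_derivative x' u) (at u)"
        using der[of u] u that by simp
      show "norm (x' u) \<le> C * u powr - q"
        using bd u that by simp
    qed
    then show ?thesis
      using g_nonneg[of t] by (simp add: dist_norm norm_minus_commute)
  qed (simp add: g_nonneg)
  have "((\<lambda>t. t powr (1 - q)) \<longlongrightarrow> 0) at_top"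
    using q by (intro tendsto_neg_powr filterlim_ident) simp
  then have "(g \<longlongrightarrow> 0) at_top"
    unfolding g_def by (rule tendsto_mult_right_zero)
  from dist_tail_bound_imp_limit[OF main this]
  obtain L where "(x \<longlongrightarrow> L) at_top" "\<And>t. s0 \<le> t \<Longrightarrow> dist (x t) L \<le> g t"
    by blast
  then show ?thesis
    by (intro that[of L]) (simp_all add: dist_norm g_def)
qed

section \<open>Geometry of the orthant and a Lipschitz estimate\<close>

lemma closed_nonneg_orthant: "closed (nonneg_orthant :: (real ^ 'm) set)"
proof -
  have "nonneg_orthant = (\<Inter>i. {r :: real ^ 'm. 0 \<le> r $ i})"
    by (auto simp: nonneg_orthant_def)
  moreover have "closed (\<Inter>i. {r :: real ^ 'm. 0 \<le> r $ i})"
    by (intro closed_INT ballI closed_Collect_le continuous_intros)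
  ultimately show ?thesis by simp
qed

lemma convex_nonneg_orthant: "convex (nonneg_orthant :: (real ^ 'm) set)"
  by (auto simp: nonneg_orthant_def convex_def)

text \<open>The continuous derivative has bounded operator norm on the compact set \<open>K\<close>,
  and convexity keeps segments inside \<open>K\<close>, so the mean value inequality applies with
  this bound.\<close>

lemma C1_on_Lipschitz_on_compact:
  assumes "C1_on S f" and K: "compact K" "convex K" "K \<subseteq> S"
  obtains L where "0 \<le> L" and "\<And>x y. x \<in> K \<Longrightarrow> y \<in> K \<Longrightarrow> norm (f x - f y) \<le> L * norm (x - y)"
proof -
  obtain f' where f': "\<And>x. x \<in> S \<Longrightarrow> (f has_derivative blinfun_apply (f' x)) (at x within S)"
    and cont: "continuous_on S f'"
    using assms(1) by (auto simp: C1_on_def)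
  have "bounded (f' ` K)"
    using K continuous_on_subset[OF cont] compact_continuous_image compact_imp_bounded by blast
  then obtain L where L: "0 < L" "\<And>x. x \<in> K \<Longrightarrow> norm (f' x) \<le> L"
    by (auto simp: bounded_pos)
  have "norm (f x - f y) \<le> L * norm (x - y)" if "x \<in> K" "y \<in> K" for x y
  proof (rule differentiable_bound[OF K(2)])
    show "(f has_derivative blinfun_apply (f' z)) (at z within K)" if "z \<in> K" for z
      using f' K(3) that has_derivative_subset by blast
    show "onorm (blinfun_apply (f' z)) \<le> L" if "z \<in> K" for z
      using L(2)[OF that] by (simp add: norm_blinfun.rep_eq)
  qed (use that in auto)
  then show ?thesis by (rule that[OF less_imp_le[OF L(1)]])
qed

section \<open>The two decay hypotheses reduced to one pointwise bound\<close>

lemma le_powr_minus_iff: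
  fixes t :: real
  assumes "0 < t"
  shows "a \<le> t powr - p \<longleftrightarrow> t powr p * a \<le> 1"
  using assms by (simp add: powr_minus field_simps)

text \<open>This is uniform convergence with tolerance 1, divided by
  \<open>t powr p\<close>.\<close>

lemma decays_uniformly_eventually_le:
  assumes "decays_uniformly p F" "compact K" "K \<subseteq> nonneg_orthant"
  shows "eventually (\<lambda>t. \<forall>r\<in>K. \<forall>\<theta>. norm (F t r \<theta>) \<le> t powr - p) at_top"
proof -
  have "uniform_limit (K \<times> UNIV) (\<lambda>t (r, \<theta>). t powr p * norm (F t r \<theta>)) (\<lambda>_. 0) at_top"
    using assms by (auto simp: decays_uniformly_def)
  then have "eventually (\<lambda>t. \<forall>z\<in>K \<times> UNIV.
      dist (case z of (r, \<theta>) \<Rightarrow> t powr p * norm (F t r \<theta>)) 0 < 1) at_top"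
    by (rule uniform_limitD) simp
  then show ?thesis
    using eventually_gt_at_top[of 0]
  proof eventually_elim
    case (elim t)
    show ?case
    proof (intro ballI allI)
      fix r \<theta> assume "r \<in> K"
      then have "t powr p * norm (F t r \<theta>) < 1"
        using elim(1) by (force simp: abs_mult)
      then show "norm (F t r \<theta>) \<le> t powr - p"
        using elim(2) by (simp add: le_powr_minus_iff)
    qed
  qed
qed

text \<open>On a set of radius \<open>B\<close>, monotonicity replaces
  \<open>\<alpha> (norm r)\<close> by the constant \<open>\<alpha> B\<close>, and
  \<open>\<alpha> B * \<beta> t\<close> falls below 1 since \<beta> tends to 0.\<close>

lemma majorized_by_eventually_le:
  assumes maj: "majorant_pair \<alpha> \<beta>" "majorized_by p \<alpha> \<beta> F" and K: "bounded K" "K \<subseteq> nonneg_orthant"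
  shows "eventually (\<lambda>t. \<forall>r\<in>K. \<forall>\<theta>. norm (F t r \<theta>) \<le> t powr - p) at_top"
proof -
  obtain B where B: "0 < B" "\<And>r. r \<in> K \<Longrightarrow> norm r \<le> B"
    using K(1) by (auto simp: bounded_pos)
  have "((\<lambda>t. \<alpha> B * \<beta> t) \<longlongrightarrow> 0) at_top"
    using maj(1) by (auto simp: majorant_pair_def intro: tendsto_mult_right_zero)
  then have "eventually (\<lambda>t. \<alpha> B * \<beta> t < 1) at_top"
    by (rule order_tendstoD) simp
  then show ?thesis
    using eventually_gt_at_top[of 0]
  proof eventually_elim
    case (elim t)
    show ?case
    proof (intro ballI allI)
      fix r \<theta> assume r: "r \<in> K"
      have "\<alpha> (norm r) \<le> \<alpha> B"
        using maj(1) B r by (auto simp: majorant_pair_def intro: mono_onD)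
      then have "\<alpha> (norm r) * \<beta> t \<le> \<alpha> B * \<beta> t"
        using maj(1) elim by (intro mult_right_mono) (auto simp: majorant_pair_def less_imp_le)
      moreover have "t powr p * norm (F t r \<theta>) \<le> \<alpha> (norm r) * \<beta> t"
        using maj(2) r K(2) elim by (auto simp: majorized_by_def)
      ultimately show "norm (F t r \<theta>) \<le> t powr - p"
        using elim by (simp add: le_powr_minus_iff)
    qed
  qed
qed

section \<open>Convergence of bounded solutions\<close>

theorem theorem5p1:
  fixes A :: "real ^ 'm \<Rightarrow> real ^ 'n"
    and P :: "real \<Rightarrow> real ^ 'm \<Rightarrow> real ^ 'n \<Rightarrow> real ^ 'm"
    and Q :: "real \<Rightarrow> real ^ 'm \<Rightarrow> real ^ 'n \<Rightarrow> real ^ 'n"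
    and T :: "real ^ 'n"
    and p t0 :: real
    and r :: "real \<Rightarrow> real ^ 'm"
    and \<theta> :: "real \<Rightarrow> real ^ 'n"
  assumes "C1_on nonneg_orthant A"
    and "\<forall>x\<in>nonneg_orthant. \<forall>k. 0 < A x $ k"
    and "\<forall>k. 0 < T $ k"
    and "torus_periodic T P" and "torus_periodic T Q"
    and "C011 P" and "C011 Q"
    and "p > 2"
    and "(decays_uniformly p P \<and> decays_uniformly p Q) \<or>
         (\<exists>\<alpha> \<beta>. majorant_pair \<alpha> \<beta> \<and> majorized_by p \<alpha> \<beta> P \<and> majorized_by p \<alpha> \<beta> Q)"
    and "bounded_solution A P Q t0 r \<theta>"
  shows "\<exists>rstar\<in>nonneg_orthant. \<exists>\<theta>0.
           ((\<lambda>t. r t - rstar) \<longlongrightarrow> 0) at_top \<and>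
           ((\<lambda>t. \<theta> t - t *\<^sub>R A rstar - \<theta>0) \<longlongrightarrow> 0) at_top"
proof -
  have sol: "r t \<in> nonneg_orthant"
      "(r has_vector_derivative P t (r t) (\<theta> t)) (at t within {t0..})"
      "(\<theta> has_vector_derivative A (r t) + Q t (r t) (\<theta> t)) (at t within {t0..})" if "t0 \<le> t" for t
    using assms(10) that by (auto simp: bounded_solution_def solution_on_half_line_def)
  obtain B where B: "\<And>t. t0 \<le> t \<Longrightarrow> norm (r t) \<le> B"
    using assms(10) by (auto simp: bounded_solution_def bounded_iff)
  define K where "K = (nonneg_orthant \<inter> cball 0 B :: (real ^ 'm) set)"
  have K: "compact K" "convex K" "K \<subseteq> nonneg_orthant"
    by (auto simp: K_def closed_nonneg_orthant convex_nonneg_orthant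
        intro: closed_Int_compact convex_Int)
  have rK: "r t \<in> K" if "t0 \<le> t" for t
    using sol(1) B that by (simp add: K_def)
  have "eventually (\<lambda>t. \<forall>x\<in>K. \<forall>y. norm (P t x y) \<le> t powr - p) at_top"
    and "eventually (\<lambda>t. \<forall>x\<in>K. \<forall>y. norm (Q t x y) \<le> t powr - p) at_top"
    using assms(9) K compact_imp_bounded[OF K(1)]
    by (auto intro: decays_uniformly_eventually_le majorized_by_eventually_le)
  then have "eventually (\<lambda>t. (\<forall>x\<in>K. \<forall>y. norm (P t x y) \<le> t powr - p) \<and>
      (\<forall>x\<in>K. \<forall>y. norm (Q t x y) \<le> t powr - p)) at_top"
    by (rule eventually_conj)
  then obtain N where N: "\<And>t. N \<le> t \<Longrightarrow> (\<forall>x\<in>K. \<forall>y. norm (P t x y) \<le> t powr - p) \<and>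
      (\<forall>x\<in>K. \<forall>y. norm (Q t x y) \<le> t powr - p)"
    by (auto simp: eventually_at_top_linorder)
  \<comment> \<open>Beyond \<open>s\<close> the solution exists and the bounds on \<open>P\<close>
    and \<open>Q\<close> hold; the entry 1 ensures \<open>t powr - p \<le> t powr (1 - p)\<close>
    later.\<close>
  define s where "s = max 1 (max t0 N)"
  have s: "1 \<le> s" "t0 \<le> s" "N \<le> s" by (auto simp: s_def)
  have sub: "{s..} \<subseteq> {t0..}" using s by auto
  obtain rstar where lim: "(r \<longlongrightarrow> rstar) at_top"
    and rate: "\<And>t. s \<le> t \<Longrightarrow> norm (r t - rstar) \<le> 1 / (p - 1) * t powr (1 - p)"
  proof (rule powr_derivative_bound_imp_limit[of p s r "\<lambda>t. P t (r t) (\<theta> t)" 1])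
    show "(r has_vector_derivative P t (r t) (\<theta> t)) (at t within {s..})" if "s \<le> t" for t
      using sol(2)[of t] that s sub has_vector_derivative_within_subset by fastforce
    show "norm (P t (r t) (\<theta> t)) \<le> 1 * t powr - p" if "s \<le> t" for t
      using N[of t] rK[of t] that s by simp
  qed (use s \<open>p > 2\<close> in auto)
  \<comment> \<open>Membership in \<open>K\<close>, and not only in the orthant, allows the
    Lipschitz estimate for \<open>A\<close> to compare \<open>r t\<close> with
    \<open>rstar\<close>.\<close>
  have rstarK: "rstar \<in> K"
  proof (rule Lim_in_closed_set[OF compact_imp_closed[OF K(1)] _ _ lim])
    show "eventually (\<lambda>t. r t \<in> K) at_top"
      using eventually_ge_at_top[of t0] by eventually_elim (rule rK)
  qed simp
  obtain L where L: "0 \<le> L"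
    "\<And>x y. x \<in> K \<Longrightarrow> y \<in> K \<Longrightarrow> norm (A x - A y) \<le> L * norm (x - y)"
    using C1_on_Lipschitz_on_compact[OF assms(1) K] by blast
  \<comment> \<open>In the constant, \<open>L / (p - 1)\<close> comes from the Lipschitz bound on
    \<open>A\<close> combined with the rate for \<open>r\<close>, and 1 comes from \<open>Q\<close>,
    whose bound is weakened by a factor \<open>t\<close> to match the exponent
    \<open>1 - p\<close>.\<close>
  obtain \<theta>0 where lim\<theta>: "((\<lambda>t. \<theta> t - t *\<^sub>R A rstar) \<longlongrightarrow> \<theta>0) at_top"
  proof (rule powr_derivative_bound_imp_limit
      [of "p - 1" s "\<lambda>t. \<theta> t - t *\<^sub>R A rstar" "\<lambda>t. A (r t) + Q t (r t) (\<theta> t) - A rstar" "L / (p - 1) + 1"])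
    fix t assume t: "s \<le> t"
    have "(\<theta> has_vector_derivative A (r t) + Q t (r t) (\<theta> t)) (at t within {s..})"
      using sol(3)[of t] t s sub has_vector_derivative_within_subset by fastforce
    then show "((\<lambda>t. \<theta> t - t *\<^sub>R A rstar) has_vector_derivative
        A (r t) + Q t (r t) (\<theta> t) - A rstar) (at t within {s..})"
      by (auto intro!: derivative_eq_intros)
    have "norm (A (r t) - A rstar) \<le> L * norm (r t - rstar)"
      using L(2) rK rstarK t s by simp
    also have "\<dots> \<le> L * (1 / (p - 1) * t powr (1 - p))"
      using rate[OF t] L(1) by (rule mult_left_mono)
    finally have A: "norm (A (r t) - A rstar) \<le> L / (p - 1) * t powr (1 - p)" by simp
    have "norm (Q t (r t) (\<theta> t)) \<le> t powr - p"
      using N[of t] rK[of t] t s by simp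
    also have "\<dots> \<le> t powr (1 - p)"
      using t s by (intro powr_mono) auto
    finally have "norm (A (r t) - A rstar + Q t (r t) (\<theta> t))
        \<le> L / (p - 1) * t powr (1 - p) + t powr (1 - p)"
      using A by (intro norm_triangle_le) simp
    then show "norm (A (r t) + Q t (r t) (\<theta> t) - A rstar) \<le> (L / (p - 1) + 1) * t powr - (p - 1)"
      by (simp add: algebra_simps)
  qed (use s \<open>p > 2\<close> in auto)
  have "((\<lambda>t. r t - rstar) \<longlongrightarrow> 0) at_top"
    using lim by (rule Lim_null[THEN iffD1])
  moreover have "((\<lambda>t. \<theta> t - t *\<^sub>R A rstar - \<theta>0) \<longlongrightarrow> 0) at_top"
    using lim\<theta> by (rule Lim_null[THEN iffD1])
  ultimately show ?thesis
    using rstarK K(3) by blast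
qed

end
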